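(* Let $\lambda\in\mathbb{R}$ and let $r\ge 0$ be an integer. For all integers $n\ge 0$ and $j$ with $0\le j\le n$, $$\sum_{k=j}^{n}(-1)^{n-k}{n+r \brack k+r}_{r,\lambda}{k+r \brace j+r}_{r,\lambda}=\delta_{n,j},$$ $$\sum_{k=j}^{n}(-1)^{k-j}{n+r\brace k+r}_{r,\lambda}{k+r\brack j+r}_{r,\lambda}=\delta_{n,j},$$ where $\delta_{n,j}$ is the Kronecker delta.
   Context: For $\lambda\in\mathbb{R}$ put $(x)_{0,\lambda}=1$, $(x)_{n,\lambda}=x(x-\lambda)\cdots(x-(n-1)\lambda)$ and $\langle x\rangle_{0,\lambda}=1$, $\langle x\rangle_{n,\lambda}=x(x+\lambda)\cdots(x+(n-1)\lambda)$ for $n\ge 1$. Also $(x)_0=\langle x\rangle_0=1$, $(x)_n=x(x-1)\cdots(x-n+1)$ and $\langle x\rangle_n=x(x+1)\cdots(x+n-1)$ for $n\ge1$. For an integer $r\ge 0$, the unsigned degenerate $r$-Stirling numbers of the first kind ${n+r \brack k+r}_{r,\lambda}$ ($0\le k\le n$) are defined by the polynomial identity in $x$: $\langle x+r\rangle_{n}=\sum_{k=0}^{n}{n+r \brack k+r}_{r,\lambda}\langle x\rangle_{k,\lambda}$ for $n\ge 0$. The degenerate $r$-Stirling numbers of the second kind ${n+r \brace k+r}_{r,\lambda}$ ($0\le k\le n$) are defined by the polynomial identity in $x$: $(x+r)_{n,\lambda}=\sum_{k=0}^{n}{n+r \brace k+r}_{r,\lambda}(x)_{k}$ for $n\ge 0$.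 *)

theory Defs
  imports Complex_Main "HOL-Computational_Algebra.Polynomial"
begin

definition falling_fact :: "real \<Rightarrow> nat \<Rightarrow> real" where
  "falling_fact x n = (\<Prod>i<n. x - real i)"

definition degen_falling :: "real \<Rightarrow> real \<Rightarrow> nat \<Rightarrow> real" where
  "degen_falling l x n = (\<Prod>i<n. x - real i * l)"

definition degen_rising :: "real \<Rightarrow> real \<Rightarrow> nat \<Rightarrow> real" where
  "degen_rising l x n = (\<Prod>i<n. x + real i * l)"

text \<open>
  Both kinds of numbers are indexed without the shift by \<open>r\<close>: \<open>degen_r_stirling1 r l n k\<close> and
  \<open>degen_r_stirling2 r l n k\<close> stand for the symbols with upper entry \<open>n + r\<close> and lower entry
  \<open>k + r\<close>. They are the coefficients in the defining expansions, set to zero for \<open>k > n\<close>;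
  the rising factorial of \<open>x + r\<close> is \<open>pochhammer\<close>. The \<open>ex1\<close> lemmas below show that the
  descriptions are proper.
\<close>

definition degen_r_stirling1 :: "nat \<Rightarrow> real \<Rightarrow> nat \<Rightarrow> nat \<Rightarrow> real" where
  "degen_r_stirling1 r l n = (THE c.
     (\<forall>x. pochhammer (x + real r) n = (\<Sum>k=0..n. c k * degen_rising l x k)) \<and>
     (\<forall>k>n. c k = 0))"

definition degen_r_stirling2 :: "nat \<Rightarrow> real \<Rightarrow> nat \<Rightarrow> nat \<Rightarrow> real" where
  "degen_r_stirling2 r l n = (THE c.
     (\<forall>x. degen_falling l (x + real r) n = (\<Sum>k=0..n. c k * falling_fact x k)) \<and>
     (\<forall>k>n. c k = 0))"

lemma poly_expansion_ex1:
  fixes q :: "nat \<Rightarrow> real poly"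
  assumes q: "\<And>k. degree (q k) = k" "\<And>k. q k \<noteq> 0"
  shows "degree p \<le> n \<Longrightarrow> \<exists>!c. p = (\<Sum>k=0..n. smult (c k) (q k)) \<and> (\<forall>k>n. c k = 0)"
proof (induction n arbitrary: p)
  case 0
  obtain b where b: "q 0 = [:b:]" using q(1)[of 0] degree_eq_zeroE by blast
  have b0: "b \<noteq> 0" using q(2)[of 0] b by auto
  obtain a where a: "p = [:a:]" using 0 degree_eq_zeroE by blast
  show ?case
  proof (rule ex1I[of _ "\<lambda>k. if k = 0 then a / b else 0"])
    show "p = (\<Sum>k=0..0. smult (if k = 0 then a / b else 0) (q k)) \<and>
        (\<forall>k::nat. k > 0 \<longrightarrow> (if k = 0 then a / b else 0) = 0)"
      using a b b0 by simp
  next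
    fix c :: "nat \<Rightarrow> real"
    assume "p = (\<Sum>k=0..0. smult (c k) (q k)) \<and> (\<forall>k>0. c k = 0)"
    then show "c = (\<lambda>k. if k = 0 then a / b else 0)" using a b b0 by (auto simp: fun_eq_iff)
  qed
next
  case (Suc n)
  let ?m = "Suc n"
  define d where "d = coeff p ?m / coeff (q ?m) ?m"
  have lq: "coeff (q ?m) ?m \<noteq> 0" using q(1)[of ?m] q(2)[of ?m] by (metis leading_coeff_0_iff)
  have lower: "coeff (\<Sum>k=0..n. smult (c k) (q k)) ?m = 0" for c
    by (simp add: coeff_sum coeff_eq_0 q(1))
  have "degree (p - smult d (q ?m)) \<le> n"
  proof (rule degree_le, intro allI impI)
    fix i assume "n < i"
    then consider "i = ?m" | "i > ?m" by linarith
    then show "coeff (p - smult d (q ?m)) i = 0"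
      using lq Suc.prems q(1)[of ?m] by cases (auto simp: d_def coeff_eq_0)
  qed
  from Suc.IH[OF this] obtain c where
    c: "p - smult d (q ?m) = (\<Sum>k=0..n. smult (c k) (q k))" "\<forall>k>n. c k = 0"
    and cu: "\<And>c'. p - smult d (q ?m) = (\<Sum>k=0..n. smult (c' k) (q k)) \<and> (\<forall>k>n. c' k = 0)
               \<Longrightarrow> c' = c"
    by blast
  show ?case
  proof (rule ex1I[of _ "c(?m := d)"])
    have "(\<Sum>k=0..n. smult ((c(?m := d)) k) (q k)) = (\<Sum>k=0..n. smult (c k) (q k))"
      by (rule sum.cong) auto
    then show "p = (\<Sum>k=0..?m. smult ((c(?m := d)) k) (q k)) \<and> (\<forall>k>?m. (c(?m := d)) k = 0)"
      using c by (auto simp: algebra_simps)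
  next
    fix e assume e: "p = (\<Sum>k=0..?m. smult (e k) (q k)) \<and> (\<forall>k>?m. e k = 0)"
    then have "coeff p ?m = e ?m * coeff (q ?m) ?m" using lower by simp
    then have ed: "e ?m = d" using lq by (simp add: d_def)
    have "(\<Sum>k=0..n. smult ((e(?m := 0)) k) (q k)) = (\<Sum>k=0..n. smult (e k) (q k))"
      by (rule sum.cong) auto
    then have "p - smult d (q ?m) = (\<Sum>k=0..n. smult ((e(?m := 0)) k) (q k)) \<and>
        (\<forall>k>n. (e(?m := 0)) k = 0)"
      using e ed by (auto simp: Suc_lessI)
    then have "e(?m := 0) = c" by (rule cu)
    then show "e = c(?m := d)" using ed by auto
  qed
qed

lemma fun_expansion_ex1:
  fixes q :: "nat \<Rightarrow> real poly"
  assumes "\<And>k. degree (q k) = k" "\<And>k. q k \<noteq> 0" "degree p \<le> n"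
    and f: "\<And>x. f x = poly p x" and g: "\<And>x k. g x k = poly (q k) x"
  shows "\<exists>!c. (\<forall>x. f x = (\<Sum>k=0..n. c k * g x k)) \<and> (\<forall>k>n. c k = 0)"
proof -
  have "(\<forall>x. f x = (\<Sum>k=0..n. c k * g x k)) \<longleftrightarrow> p = (\<Sum>k=0..n. smult (c k) (q k))" for c
    unfolding poly_eq_poly_eq_iff[symmetric] by (simp add: fun_eq_iff poly_sum f g)
  then show ?thesis using poly_expansion_ex1[OF assms(1,2,3)] by simp
qed

lemma degree_prod_linear: "degree (\<Prod>i<n. [:a i, 1::real:]) = n"
  by (subst degree_prod_eq_sum_degree) auto

lemma prod_linear_nonzero: "(\<Prod>i<n::nat. [:a i, 1::real:]) \<noteq> 0"
  by simp

lemma degen_r_stirling1_ex1: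
  "\<exists>!c. (\<forall>x. pochhammer (x + real r) n = (\<Sum>k=0..n. c k * degen_rising l x k)) \<and>
        (\<forall>k>n. c k = 0)"
  by (rule fun_expansion_ex1[where q = "\<lambda>k. \<Prod>i<k. [:real i * l, 1:]"
        and p = "\<Prod>i<n. [:real r + real i, 1:]"])
     (simp_all only: degree_prod_linear prod_linear_nonzero order_refl not_False_eq_True,
      simp_all add: pochhammer_prod degen_rising_def poly_prod atLeast0LessThan algebra_simps)

lemma degen_r_stirling2_ex1:
  "\<exists>!c. (\<forall>x. degen_falling l (x + real r) n = (\<Sum>k=0..n. c k * falling_fact x k)) \<and>
        (\<forall>k>n. c k = 0)"
  by (rule fun_expansion_ex1[where q = "\<lambda>k. \<Prod>i<k. [:- real i, 1:]"
        and p = "\<Prod>i<n. [:real r - real i * l, 1:]"])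
     (simp_all only: degree_prod_linear prod_linear_nonzero order_refl not_False_eq_True,
      simp_all add: degen_falling_def falling_fact_def poly_prod algebra_simps)

end

theory Submission imports Defs begin

text \<open>
  The two orthogonality relations say that two triangular matrices are inverse to each other, and
  they hold because these matrices convert between the same two bases of the polynomials, namely
  \<open>(x)\<^sub>n\<close> and \<open>(x + r)\<^sub>n\<^sub>,\<^sub>\<lambda>\<close>. The numbers of the second kind expand \<open>(x + r)\<^sub>n\<^sub>,\<^sub>\<lambda>\<close> in the
  \<open>(x)\<^sub>k\<close> by definition. Those of the first kind are defined by rising factorials, but replacing
  \<open>x\<close> by \<open>- (x + r)\<close> in their definition turns both sides into falling factorials, at the cost of
  signs: \<open>\<langle>- x\<rangle>\<^sub>n = (-1)\<^sup>n (x)\<^sub>n\<close> and \<open>\<langle>- (x + r)\<rangle>\<^sub>k\<^sub>,\<^sub>\<lambda> = (-1)\<^sup>k (x + r)\<^sub>k\<^sub>,\<^sub>\<lambda>\<close>. So the signed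
  numbers \<open>(-1)\<^sup>n\<^sup>-\<^sup>k\<close> times those of the first kind expand \<open>(x)\<^sub>n\<close> in the \<open>(x + r)\<^sub>k\<^sub>,\<^sub>\<lambda>\<close>
  (\<open>falling_fact_expansion\<close>). Substituting either expansion into the other and comparing
  coefficients (\<open>connection_coefficients_inverse\<close>) gives the two relations.
\<close>

text \<open>
  The products are monic of distinct degrees, so uniqueness of expansions applies to the zero
  polynomial.
\<close>

lemma linear_products_independent:
  fixes a c :: "nat \<Rightarrow> real"
  assumes zero: "\<And>x. (\<Sum>k=0..n. c k * (\<Prod>i<k. x + a i)) = 0" and "j \<le> n"
  shows "c j = 0"
proof -
  have ex1: "\<exists>!d. (\<forall>x. (0::real) = (\<Sum>k=0..n. d k * (\<Prod>i<k. x + a i))) \<and> (\<forall>k>n. d k = 0)"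
    by (rule fun_expansion_ex1[where q = "\<lambda>k. \<Prod>i<k. [:a i, 1:]" and p = 0])
       (simp_all only: degree_prod_linear prod_linear_nonzero not_False_eq_True,
        simp_all add: poly_prod algebra_simps)
  \<comment> \<open>Uniqueness concerns coefficient sequences that vanish beyond \<open>n\<close>, hence the truncation.\<close>
  define d where "d k = (if k \<le> n then c k else 0)" for k
  have "(\<Sum>k=0..n. d k * (\<Prod>i<k. x + a i)) = (\<Sum>k=0..n. c k * (\<Prod>i<k. x + a i))" for x
    by (rule sum.cong) (auto simp: d_def)
  then have "(\<forall>x. 0 = (\<Sum>k=0..n. d k * (\<Prod>i<k. x + a i))) \<and> (\<forall>k>n. d k = 0)"
    using zero by (simp add: d_def)
  moreover have "(\<forall>x. 0 = (\<Sum>k=0..n. 0 * (\<Prod>i<k. x + a i))) \<and> (\<forall>k>n. (0::real) = 0)"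
    by simp
  ultimately have "d = (\<lambda>_. 0)"
    by (rule trans[OF the1_equality[OF ex1, symmetric] the1_equality[OF ex1]])
  then have "d j = 0" by simp
  then show ?thesis using \<open>j \<le> n\<close> by (simp add: d_def)
qed

text \<open>
  Expanding \<open>f\<close> in \<open>g\<close> and then \<open>g\<close> back in \<open>f\<close> gives an expansion of \<open>f\<close> in itself with the
  entries of the matrix product \<open>A B\<close> as coefficients; since the \<open>f\<close> are independent, this
  product is the identity.
\<close>

lemma connection_coefficients_inverse:
  fixes A B :: "nat \<Rightarrow> nat \<Rightarrow> real" and f g :: "real \<Rightarrow> nat \<Rightarrow> real"
  assumes f: "\<And>x k. f x k = (\<Prod>i<k. x + a i)"
    and fg: "\<And>x n. f x n = (\<Sum>k=0..n. A n k * g x k)"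
    and gf: "\<And>x n. g x n = (\<Sum>k=0..n. B n k * f x k)"
    and "j \<le> n"
  shows "(\<Sum>k=j..n. A n k * B k j) = (if n = j then 1 else 0)"
proof -
  define C where "C j = (\<Sum>k=j..n. A n k * B k j)" for j
  have "(\<Sum>j=0..n. (C j - (if n = j then 1 else 0)) * (\<Prod>i<j. x + a i)) = 0" for x
  proof -
    have "f x n = (\<Sum>k=0..n. \<Sum>j=0..k. A n k * B k j * f x j)"
      by (subst fg, subst gf) (simp add: sum_distrib_left mult.assoc)
    also have "\<dots> = (\<Sum>k\<in>{0..n}. \<Sum>j\<in>{j\<in>{0..n}. j \<le> k}. A n k * B k j * f x j)"
      by (intro sum.cong) auto
    also have "\<dots> = (\<Sum>j\<in>{0..n}. \<Sum>k\<in>{k\<in>{0..n}. j \<le> k}. A n k * B k j * f x j)"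
      by (rule sum.swap_restrict) auto
    also have "\<dots> = (\<Sum>j=0..n. \<Sum>k=j..n. A n k * B k j * f x j)"
      by (intro sum.cong) auto
    also have "\<dots> = (\<Sum>j=0..n. C j * f x j)"
      by (simp add: C_def sum_distrib_right)
    finally have "f x n = (\<Sum>j=0..n. C j * f x j)" .
    moreover have "(\<Sum>j=0..n. (if n = j then 1 else 0) * f x j) = f x n"
      by (simp add: if_distrib[of "\<lambda>t. t * _"] cong: if_cong)
    ultimately show ?thesis
      unfolding f[symmetric] by (simp add: left_diff_distrib sum_subtractf)
  qed
  then have "C j - (if n = j then 1 else 0) = 0"
    using \<open>j \<le> n\<close> by (rule linear_products_independent)
  then show ?thesis by (simp add: C_def)
qed

lemma degen_r_stirling1_expansion:
  "pochhammer (x + real r) n = (\<Sum>k=0..n. degen_r_stirling1 r l n k * degen_rising l x k)"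
  using theI'[OF degen_r_stirling1_ex1[of r n l], folded degen_r_stirling1_def, THEN conjunct1]
  by (rule spec)

lemma degen_r_stirling2_expansion:
  "degen_falling l (x + real r) n = (\<Sum>k=0..n. degen_r_stirling2 r l n k * falling_fact x k)"
  using theI'[OF degen_r_stirling2_ex1[of l r n], folded degen_r_stirling2_def, THEN conjunct1]
  by (rule spec)

lemma degen_rising_uminus: "degen_rising l (- x) n = (-1) ^ n * degen_falling l x n"
proof (induction n)
  case (Suc n)
  then show ?case by (simp add: degen_rising_def degen_falling_def algebra_simps)
qed (simp add: degen_rising_def degen_falling_def)

lemma pochhammer_uminus_falling_fact: "pochhammer (- x) n = (-1) ^ n * falling_fact x n"
proof (induction n)
  case (Suc n)
  then show ?case by (simp add: pochhammer_Suc falling_fact_def algebra_simps)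
qed (simp add: falling_fact_def)

text \<open>
  The argument \<open>- (x + r)\<close> is chosen so that the shift by \<open>r\<close> in the defining expansion
  disappears from the left-hand side and reappears on the right.
\<close>

lemma falling_fact_expansion:
  "falling_fact x n =
     (\<Sum>k=0..n. (-1) ^ (n - k) * degen_r_stirling1 r l n k * degen_falling l (x + real r) k)"
proof -
  have "falling_fact x n = (-1) ^ n * pochhammer (- (x + real r) + real r) n"
    by (simp add: pochhammer_uminus_falling_fact flip: mult.assoc power_mult_distrib)
  also have "\<dots> = (\<Sum>k=0..n. (-1) ^ n * (degen_r_stirling1 r l n k *
                      ((-1) ^ k * degen_falling l (x + real r) k)))"
    by (simp only: degen_r_stirling1_expansion[of _ r n l] degen_rising_uminus sum_distrib_left)
  also have "\<dots> = (\<Sum>k=0..n. (-1) ^ (n - k) * degen_r_stirling1 r l n k *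
                      degen_falling l (x + real r) k)"
  proof (rule sum.cong)
    fix k assume "k \<in> {0..n}"
    then have "(-1::real) ^ (n - k) = (-1) ^ n * (-1) ^ k"
      by (simp add: minus_one_power_iff)
    then show "(-1) ^ n * (degen_r_stirling1 r l n k *
        ((-1) ^ k * degen_falling l (x + real r) k)) =
      (-1) ^ (n - k) * degen_r_stirling1 r l n k * degen_falling l (x + real r) k"
      by (simp add: mult_ac)
  qed simp
  finally show ?thesis .
qed

theorem theorem1:
  fixes l :: real and r n j :: nat
  assumes "j \<le> n"
  shows "(\<Sum>k=j..n. (-1) ^ (n - k) * degen_r_stirling1 r l n k * degen_r_stirling2 r l k j)
           = (if n = j then 1 else 0) \<and>
         (\<Sum>k=j..n. (-1) ^ (k - j) * degen_r_stirling2 r l n k * degen_r_stirling1 r l k j)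
           = (if n = j then 1 else 0)"
proof
  let ?A = "\<lambda>n k. (-1) ^ (n - k) * degen_r_stirling1 r l n k"
  let ?B = "degen_r_stirling2 r l"
  let ?g = "\<lambda>x. degen_falling l (x + real r)"
  show "(\<Sum>k=j..n. ?A n k * ?B k j) = (if n = j then 1 else 0)"
    by (rule connection_coefficients_inverse[where f = falling_fact and g = ?g
          and a = "\<lambda>i. - real i", OF _ falling_fact_expansion degen_r_stirling2_expansion assms])
       (simp add: falling_fact_def)
  have "(\<Sum>k=j..n. ?B n k * ?A k j) = (if n = j then 1 else 0)"
    by (rule connection_coefficients_inverse[where f = ?g and g = falling_fact
          and a = "\<lambda>i. real r - real i * l",
          OF _ degen_r_stirling2_expansion falling_fact_expansion assms])
       (simp add: degen_falling_def algebra_simps)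
  then show "(\<Sum>k=j..n. (-1) ^ (k - j) * ?B n k * degen_r_stirling1 r l k j)
      = (if n = j then 1 else 0)"
    by (simp add: mult_ac)
qed

end
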